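(* Let $k$ be an algebraically closed field of characteristic zero, let $h=x^4+y^4+z^4+t^4+12xyzt$ and $G_{1920}=\mathrm{Paut}(V(h))\subset PGL_4(k)$. With $T\in GL_4(k)$, the subgroup $\mathbf{S}_5(1)\cong\mathbf{S}_5$ of $PGL_4(k)$ and the quartic forms $g_0,g_1$ defined in the context: (1) $G_{1920}$ contains the subgroup $(T)^{-1}\,\mathbf{S}_5(1)\,(T)$. (2) $\alpha h_T=g_0+\lambda g_1$, where $\alpha=27(-1+3i)/2$ and $\lambda=(-8+9i)/4$.
   Context: $i\in k$ satisfies $i^2=-1$; $\sqrt3,\sqrt5\in k$ are fixed square roots, $\sqrt{15}=\sqrt3\sqrt5$, $\omega=(-1+i\sqrt3)/2$. For $A\in GL_4(k)$, $(A)$ denotes its class in $PGL_4(k)$. For a form $f$ in $x,y,z,t$ and $A\in GL_4(k)$, $f_A(v)=f(A^{-1}v)$, where $v$ is the column vector with entries $x,y,z,t$. $V(h)=\{(a)\in P^3:h(a)=0\}$ and $\mathrm{Paut}(V(h))=\{(A)\in PGL_4(k):(A)V(h)=V(h)\}$. $$T=\mathrm{diag}\left(-\frac{\sqrt{15}}{20},\frac14,1,1\right)\begin{pmatrix}3+i&1-3i&3+i&7-i\\1+3i&3-i&1+3i&-3-3i\\\omega^2&-i\omega&1&0\\\omega&-i\omega^2&1&0\end{pmatrix}.$$ $\mathbf{S}_5(1)$ is the image of the faithful representation $\Phi_1:\mathbf{S}_5\to PGL_4(k)$ with $\Phi_1((123))=(R_{11})$, $\Phi_1((12)(34))=(R_{12})$,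 $\Phi_1((12)(45))=(R_{13})$, $\Phi_1((12))=(R_{14})$ (i.e. the subgroup generated by these four classes), where $R_{11}=\mathrm{diag}(1,1,\omega,\omega^2)$, $$R_{12}=\begin{pmatrix}1&0&0&0\\0&-\frac13&\frac23&\frac23\\0&\frac23&-\frac13&\frac23\\0&\frac23&\frac23&-\frac13\end{pmatrix},\quad R_{13}=\begin{pmatrix}-\frac14&\frac{\sqrt{15}}4&0&0\\\frac{\sqrt{15}}4&\frac14&0&0\\0&0&0&1\\0&0&1&0\end{pmatrix},\quad R_{14}=\begin{pmatrix}1&0&0&0\\0&1&0&0\\0&0&0&1\\0&0&1&0\end{pmatrix}.$$ $g_0=-x^4+2\sqrt{15}(y^3+z^3+t^3)x+10(z^3+t^3)y+13x^2y^2+5z^2t^2+(26x^2+20y^2)zt-6\sqrt{15}xyzt$, $g_1=x^4+y^4+2x^2y^2+4z^2t^2+4(x^2+y^2)zt$. *)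

theory Defs
  imports
    "HOL-Analysis.Determinants"
    "HOL-Algebra.Generated_Groups"
    "HOL-Library.Poly_Mapping"
    "HOL-Computational_Algebra.Polynomial"
begin

section \<open>Polynomials in four variables\<close>

text \<open>
  Polynomials in x, y, z, t are finitely supported maps from exponent vectors to coefficients, with
  the convolution product of \<^theory>\<open>HOL-Library.Poly_Mapping\<close>. The variables are indexed by the
  four-element type \<^typ>\<open>4\<close>, in which \<^term>\<open>4 = (0 :: 4)\<close>, so that they match the entries of vectors
  of type \<^typ>\<open>'k ^ 4\<close>.
\<close>

type_synonym 'k poly4 = "(4 \<Rightarrow>\<^sub>0 nat) \<Rightarrow>\<^sub>0 'k"

definition Cst :: "'k::zero \<Rightarrow> 'k poly4" where
  "Cst c = Poly_Mapping.single 0 c"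

definition Var :: "4 \<Rightarrow> 'k::zero_neq_one poly4" where
  "Var j = Poly_Mapping.single (Poly_Mapping.single j 1) 1"

text \<open>Value of a polynomial at \<^term>\<open>\<theta>\<close>, with the coefficients mapped along \<^term>\<open>\<phi>\<close>. It is used both
  for evaluation at a point of the affine space and for substitution of polynomials.\<close>

definition eval4 :: "('k::zero \<Rightarrow> 'r::comm_semiring_1) \<Rightarrow> (4 \<Rightarrow> 'r) \<Rightarrow> 'k poly4 \<Rightarrow> 'r" where
  "eval4 \<phi> \<theta> f = (\<Sum>m\<in>Poly_Mapping.keys f.
      \<phi> (Poly_Mapping.lookup f m) * (\<Prod>j\<in>UNIV. \<theta> j ^ Poly_Mapping.lookup m j))"

text \<open>The form \<open>f\<^sub>A(v) = f(A\<^sup>-\<^sup>1 v)\<close>, where \<open>v\<close> is the column of the four variables.\<close>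

definition act_form :: "'k::field ^ 4 ^ 4 \<Rightarrow> 'k poly4 \<Rightarrow> 'k poly4" where
  "act_form A f = eval4 Cst (\<lambda>j. \<Sum>l\<in>UNIV. Cst (matrix_inv A $ j $ l) * Var l) f"


section \<open>The group \<open>PGL\<^sub>4(k)\<close> acting on \<open>P\<^sup>3\<close>\<close>

definition GL4 :: "('k::field ^ 4 ^ 4) monoid" where
  "GL4 = \<lparr>carrier = {A. invertible A}, mult = (**), one = mat 1\<rparr>"

definition scalars4 :: "('k::field ^ 4 ^ 4) set" where
  "scalars4 = {mat c | c. c \<noteq> 0}"

definition PGL4 :: "('k::field ^ 4 ^ 4) set monoid" where
  "PGL4 = GL4 Mod scalars4"

definition mat_class :: "'k::field ^ 4 ^ 4 \<Rightarrow> ('k ^ 4 ^ 4) set" where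
  "mat_class A = scalars4 #>\<^bsub>GL4\<^esub> A"

lemma mat_scalar_comm: "mat c ** A = A ** mat c" for A :: "'k::field ^ 4 ^ 4"
  by (simp add: vec_eq_iff forall_4 sum_4 matrix_matrix_mult_def mat_def mult.commute)

lemma mat_mult_mat: "mat c ** mat d = (mat (c * d) :: 'k::field ^ 4 ^ 4)"
  by (simp add: vec_eq_iff forall_4 sum_4 matrix_matrix_mult_def mat_def)

lemma invertible_mat_scalar: "c \<noteq> 0 \<Longrightarrow> invertible (mat c :: 'k::field ^ 4 ^ 4)"
  unfolding invertible_def by (rule exI[of _ "mat (inverse c)"]) (simp add: mat_mult_mat)

lemma group_GL4: "group (GL4 :: ('k::field ^ 4 ^ 4) monoid)"
proof (rule groupI)
  fix A :: "'k ^ 4 ^ 4" assume "A \<in> carrier GL4"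
  then obtain B where "A ** B = mat 1" "B ** A = mat 1"
    by (auto simp: GL4_def invertible_def)
  then show "\<exists>B\<in>carrier GL4. B \<otimes>\<^bsub>GL4\<^esub> A = \<one>\<^bsub>GL4\<^esub>"
    by (auto simp: GL4_def invertible_def)
qed (auto simp: GL4_def invertible_mult matrix_mul_assoc intro: invertible_mat_scalar)

lemma normal_scalars4: "scalars4 \<lhd> (GL4 :: ('k::field ^ 4 ^ 4) monoid)"
proof -
  interpret group "GL4 :: ('k ^ 4 ^ 4) monoid" by (rule group_GL4)
  have sub: "subgroup scalars4 (GL4 :: ('k ^ 4 ^ 4) monoid)"
  proof (rule subgroupI)
    fix A :: "'k ^ 4 ^ 4" assume "A \<in> scalars4"
    then obtain c where c: "c \<noteq> 0" "A = mat c" by (auto simp: scalars4_def)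
    have "inv\<^bsub>GL4\<^esub> A = mat (inverse c)"
      using c by (intro inv_equality) (auto simp: GL4_def mat_mult_mat intro: invertible_mat_scalar)
    then show "inv\<^bsub>GL4\<^esub> A \<in> scalars4" using c by (auto simp: scalars4_def)
  next
    fix A B :: "'k ^ 4 ^ 4" assume "A \<in> scalars4" "B \<in> scalars4"
    then show "A \<otimes>\<^bsub>GL4\<^esub> B \<in> scalars4"
      by (force simp: scalars4_def GL4_def mat_mult_mat)
  qed (auto simp: scalars4_def GL4_def intro: invertible_mat_scalar exI[of _ 1])
  show ?thesis
  proof (rule normalI[OF sub], rule ballI)
    fix A :: "'k ^ 4 ^ 4" assume "A \<in> carrier GL4"
    show "scalars4 #>\<^bsub>GL4\<^esub> A = A <#\<^bsub>GL4\<^esub> scalars4"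
      by (auto simp: r_coset_def l_coset_def scalars4_def GL4_def mat_scalar_comm)
  qed
qed

lemma group_PGL4: "group PGL4"
  unfolding PGL4_def by (rule normal.factorgroup_is_group[OF normal_scalars4])

text \<open>A point of \<open>P\<^sup>3\<close> is the set of its homogeneous coordinate vectors. For a form \<open>h\<close> the
  condition in the definition of \<open>V\<close> does not depend on the chosen representative.\<close>

definition point :: "'k::field ^ 4 \<Rightarrow> ('k ^ 4) set" where
  "point a = {c *s a | c. c \<noteq> 0}"

definition V :: "'k::field poly4 \<Rightarrow> ('k ^ 4) set set" where
  "V h = {point a | a. a \<noteq> 0 \<and> eval4 id (($) a) h = 0}"

definition act_point :: "('k::field ^ 4 ^ 4) set \<Rightarrow> ('k ^ 4) set \<Rightarrow> ('k ^ 4) set" where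
  "act_point g p = {A *v a | A a. A \<in> g \<and> a \<in> p}"

definition Paut :: "('k::field ^ 4) set set \<Rightarrow> ('k ^ 4 ^ 4) set set" where
  "Paut S = {g \<in> carrier PGL4. act_point g ` S = S}"


section \<open>The matrices and the forms\<close>

text \<open>Throughout, \<open>i\<close>, \<open>s3\<close>, \<open>s5\<close> stand for the chosen square roots of -1, 3 and 5 in the field.\<close>

definition mat4 :: "'k::zero list list \<Rightarrow> 'k ^ 4 ^ 4" where
  "mat4 rs = vector (map vector rs)"

definition diag4 :: "'k::zero \<Rightarrow> 'k \<Rightarrow> 'k \<Rightarrow> 'k \<Rightarrow> 'k ^ 4 ^ 4" where
  "diag4 a b c d = mat4 [[a, 0, 0, 0], [0, b, 0, 0], [0, 0, c, 0], [0, 0, 0, d]]"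

definition omega :: "'k::field \<Rightarrow> 'k \<Rightarrow> 'k" where
  "omega i s3 = (- 1 + i * s3) / 2"

definition T_mat :: "'k::field \<Rightarrow> 'k \<Rightarrow> 'k \<Rightarrow> 'k ^ 4 ^ 4" where
  "T_mat i s3 s5 = (let w = omega i s3 in
     diag4 (- (s3 * s5) / 20) (1 / 4) 1 1 **
     mat4 [[3 + i,     1 - 3 * i,   3 + i,     7 - i],
           [1 + 3 * i, 3 - i,       1 + 3 * i, - 3 - 3 * i],
           [w\<^sup>2,        - i * w,     1,         0],
           [w,         - i * w\<^sup>2,   1,         0]])"

definition R11 :: "'k::field \<Rightarrow> 'k \<Rightarrow> 'k ^ 4 ^ 4" where
  "R11 i s3 = diag4 1 1 (omega i s3) ((omega i s3)\<^sup>2)"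

definition R12 :: "'k::field ^ 4 ^ 4" where
  "R12 = mat4 [[1, 0, 0, 0],
               [0, - 1 / 3, 2 / 3, 2 / 3],
               [0, 2 / 3, - 1 / 3, 2 / 3],
               [0, 2 / 3, 2 / 3, - 1 / 3]]"

definition R13 :: "'k::field \<Rightarrow> 'k \<Rightarrow> 'k ^ 4 ^ 4" where
  "R13 s3 s5 = mat4 [[- 1 / 4, s3 * s5 / 4, 0, 0],
                     [s3 * s5 / 4, 1 / 4, 0, 0],
                     [0, 0, 0, 1],
                     [0, 0, 1, 0]]"

definition R14 :: "'k::field ^ 4 ^ 4" where
  "R14 = mat4 [[1, 0, 0, 0],
               [0, 1, 0, 0],
               [0, 0, 0, 1],
               [0, 0, 1, 0]]"

lemma mat_mult_GL4:
  assumes "A ** B = mat c" "c \<noteq> 0" shows "A \<in> carrier GL4"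
proof -
  have "A ** (B ** mat (inverse c)) = mat 1"
    using assms by (simp add: matrix_mul_assoc mat_mult_mat)
  then show ?thesis
    using invertible_right_inverse by (auto simp: GL4_def)
qed

lemma mat4_mult:
  "mat4 [[a11, a12, a13, a14], [a21, a22, a23, a24], [a31, a32, a33, a34], [a41, a42, a43, a44]] **
   mat4 [[b11, b12, b13, b14], [b21, b22, b23, b24], [b31, b32, b33, b34], [b41, b42, b43, b44]] =
   mat4 [[a11 * b11 + a12 * b21 + a13 * b31 + a14 * b41, a11 * b12 + a12 * b22 + a13 * b32 + a14 * b42,
          a11 * b13 + a12 * b23 + a13 * b33 + a14 * b43, a11 * b14 + a12 * b24 + a13 * b34 + a14 * b44],
         [a21 * b11 + a22 * b21 + a23 * b31 + a24 * b41, a21 * b12 + a22 * b22 + a23 * b32 + a24 * b42,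
          a21 * b13 + a22 * b23 + a23 * b33 + a24 * b43, a21 * b14 + a22 * b24 + a23 * b34 + a24 * b44],
         [a31 * b11 + a32 * b21 + a33 * b31 + a34 * b41, a31 * b12 + a32 * b22 + a33 * b32 + a34 * b42,
          a31 * b13 + a32 * b23 + a33 * b33 + a34 * b43, a31 * b14 + a32 * b24 + a33 * b34 + a34 * b44],
         [a41 * b11 + a42 * b21 + a43 * b31 + a44 * b41, a41 * b12 + a42 * b22 + a43 * b32 + a44 * b42,
          a41 * b13 + a42 * b23 + a43 * b33 + a44 * b43, a41 * b14 + a42 * b24 + a43 * b34 + a44 * b44]]"
  by (simp add: vec_eq_iff forall_4 sum_4 matrix_matrix_mult_def mat4_def vector_def)

lemma mat4_scalar:
  "mat c = mat4 [[c, 0, 0, 0], [0, c, 0, 0], [0, 0, c, 0], [0, 0, 0, c]]"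
  by (simp add: vec_eq_iff forall_4 mat4_def vector_def mat_def)

lemma diag4_GL4:
  assumes "a \<noteq> 0" "b \<noteq> 0" "c \<noteq> 0" "d \<noteq> 0" shows "diag4 a b c d \<in> carrier GL4"
proof (rule mat_mult_GL4)
  show "diag4 a b c d ** diag4 (inverse a) (inverse b) (inverse c) (inverse d) = mat 1"
    using assms by (simp add: diag4_def mat4_mult mat4_scalar)
qed simp

lemma omega_root:
  fixes i s3 :: "'k::field_char_0"
  assumes "i\<^sup>2 = - 1" "s3\<^sup>2 = 3"
  shows "(omega i s3)\<^sup>2 = - 1 - omega i s3"
proof -
  have "4 * ((omega i s3)\<^sup>2 + omega i s3 + 1) = 3 + (i * s3)\<^sup>2"
    unfolding omega_def by (simp add: power2_eq_square field_simps)
  also have "\<dots> = 0" using assms by (simp add: power_mult_distrib)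
  finally have "(omega i s3)\<^sup>2 + omega i s3 + 1 = 0"
    unfolding mult_eq_0_iff by simp
  then have "(omega i s3)\<^sup>2 = 0 - 1 - omega i s3"
    unfolding diff_diff_eq eq_diff_eq by (simp only: ac_simps)
  then show ?thesis by simp
qed

lemma T_mat_GL4:
  fixes i s3 s5 :: "'k::field_char_0"
  assumes i: "i\<^sup>2 = - 1" and s: "s3\<^sup>2 = 3" "s5\<^sup>2 = 5"
  shows "T_mat i s3 s5 \<in> carrier GL4"
proof -
  define w where "w = omega i s3"
  have w: "w\<^sup>2 = - 1 - w" unfolding w_def by (rule omega_root[OF i s(1)])
  have r1: "i * i = - 1" "w * w = - 1 - w" using i w by (simp_all add: power2_eq_square)
  have r2: "i * (i * a) = - a" "w * (w * a) = - a - w * a" for a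
    using arg_cong[OF r1(1), of "\<lambda>u. u * a"] arg_cong[OF r1(2), of "\<lambda>u. u * a"]
    by (simp_all add: mult.assoc left_diff_distrib)
  define M where "M = mat4 [[3 + i, 1 - 3 * i, 3 + i, 7 - i],
           [1 + 3 * i, 3 - i, 1 + 3 * i, - 3 - 3 * i],
           [w\<^sup>2, - i * w, 1, 0], [w, - i * w\<^sup>2, 1, 0]]"
  define N where "N = mat4 [[9 - 3 * i, 5 - 15 * i, 80 * w, 80 * w\<^sup>2],
           [3 + 9 * i, 15 + 5 * i, 80 * i * w\<^sup>2, 80 * i * w],
           [9 - 3 * i, 5 - 15 * i, 80, 80], [21 + 3 * i, - 15 + 15 * i, 0, 0]]"
  have "M ** N = mat 240"
    unfolding M_def N_def w mat4_mult mat4_scalar by (simp add: algebra_simps r1 r2)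
  then have M: "M \<in> carrier GL4" by (rule mat_mult_GL4) simp
  have "s3 \<noteq> 0" "s5 \<noteq> 0" using s by auto
  then have D: "diag4 (- (s3 * s5) / 20) (1 / 4) 1 1 \<in> carrier GL4"
    by (intro diag4_GL4) auto
  have "T_mat i s3 s5 = diag4 (- (s3 * s5) / 20) (1 / 4) 1 1 ** M"
    by (simp add: T_mat_def M_def w_def Let_def)
  then show ?thesis using D M by (auto simp: GL4_def intro: invertible_mult)
qed

lemma R_GL4:
  fixes i s3 s5 :: "'k::field_char_0"
  assumes i: "i\<^sup>2 = - 1" and s: "s3\<^sup>2 = 3" "s5\<^sup>2 = 5"
  shows "{R11 i s3, R12, R13 s3 s5, R14} \<subseteq> carrier GL4"
proof -
  have "omega i s3 \<noteq> 0" using omega_root[OF i s(1)] by auto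
  then have "R11 i s3 \<in> carrier GL4"
    unfolding R11_def by (intro diag4_GL4) auto
  moreover have "(R12 :: 'k ^ 4 ^ 4) \<in> carrier GL4"
    by (rule mat_mult_GL4[of _ R12 1]) (simp_all add: R12_def mat4_mult mat4_scalar)
  moreover have "R13 s3 s5 \<in> carrier GL4"
  proof (rule mat_mult_GL4[of _ "R13 s3 s5" 1])
    have "s3 * s5 * (s3 * s5) = s3\<^sup>2 * s5\<^sup>2"
      by (simp only: power2_eq_square mult_ac)
    then have "s3 * s5 * (s3 * s5) = 15" using s by simp
    then show "R13 s3 s5 ** R13 s3 s5 = mat 1"
      by (simp add: R13_def mat4_mult mat4_scalar)
  qed simp
  moreover have "(R14 :: 'k ^ 4 ^ 4) \<in> carrier GL4"
    by (rule mat_mult_GL4[of _ R14 1]) (simp_all add: R14_def mat4_mult mat4_scalar)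
  ultimately show ?thesis by simp
qed

text \<open>The four classes are the images of (123), (12)(34), (12)(45), (12) under the faithful
  representation of the symmetric group of degree 5. These permutations generate that group, so the
  subgroup below is the image of the representation.\<close>

definition S5_1 :: "'k::field \<Rightarrow> 'k \<Rightarrow> 'k \<Rightarrow> ('k ^ 4 ^ 4) set set" where
  "S5_1 i s3 s5 =
     generate PGL4 {mat_class (R11 i s3), mat_class R12, mat_class (R13 s3 s5), mat_class R14}"

abbreviation "vx \<equiv> Var 1"
abbreviation "vy \<equiv> Var 2"
abbreviation "vz \<equiv> Var 3"
abbreviation "vt \<equiv> Var 4"

definition h_form :: "'k::field poly4" where
  "h_form = vx ^ 4 + vy ^ 4 + vz ^ 4 + vt ^ 4 + 12 * vx * vy * vz * vt"

definition g0_form :: "'k::field \<Rightarrow> 'k \<Rightarrow> 'k poly4" where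
  "g0_form s3 s5 = (let s15 = Cst (s3 * s5) in
     - (vx ^ 4) + 2 * s15 * (vy ^ 3 + vz ^ 3 + vt ^ 3) * vx + 10 * (vz ^ 3 + vt ^ 3) * vy
     + 13 * vx\<^sup>2 * vy\<^sup>2 + 5 * vz\<^sup>2 * vt\<^sup>2 + (26 * vx\<^sup>2 + 20 * vy\<^sup>2) * vz * vt
     - 6 * s15 * vx * vy * vz * vt)"

definition g1_form :: "'k::field poly4" where
  "g1_form = vx ^ 4 + vy ^ 4 + 2 * vx\<^sup>2 * vy\<^sup>2 + 4 * vz\<^sup>2 * vt\<^sup>2 + 4 * (vx\<^sup>2 + vy\<^sup>2) * vz * vt"

abbreviation G1920 :: "('k::field ^ 4 ^ 4) set set" where
  "G1920 \<equiv> Paut (V h_form)"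

end

theory Submission
  imports Defs "HOL-Algebra.Group_Action"
begin

text \<open>The surface with equation \<open>h\<close> is hard to see as symmetric under the fifth symmetric group, but in
  the coordinates given by \<open>T\<close> the symmetry becomes visible. Write \<open>q = x\<^sup>2 + y\<^sup>2 + 2zt\<close>; then
  \<open>g\<^sub>1 = q\<^sup>2\<close>, and both \<open>q\<close> and \<open>g\<^sub>0\<close> are fixed by each of the four generating matrices
  (\<open>invariant_cube_root_of_unity\<close>, \<open>invariant_reflection\<close>, \<open>invariant_R13\<close>, \<open>invariant_swap\<close>).
  Hence the group they generate preserves every surface of the pencil \<open>g\<^sub>0 + \<lambda>g\<^sub>1\<close>. The second claim
  places the transformed quartic \<open>h\<^sub>T\<close>, up to a nonzero factor, in this pencil. So \<open>T\<close> carries the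
  surface of \<open>h\<close> onto a surface of the pencil, and conjugating by \<open>T\<close> moves the automorphisms of the
  latter to automorphisms of the former.

  For the second claim, the point is the shape of the inverse of \<open>T\<close>. Let \<open>\<omega>\<close> be a primitive cube
  root of unity. The first three rows are, up to a common scalar and a factor \<open>i\<close> in the
  second, the linear forms \<open>a + \<zeta>z + \<zeta>\<^sup>2t\<close>, where \<open>\<zeta>\<close> runs through \<open>\<omega>\<close>, \<open>\<omega>\<^sup>2\<close>, \<open>1\<close> and \<open>a\<close> depends on
  \<open>x\<close> and \<open>y\<close> only; the last row is a form \<open>d\<close> in \<open>x\<close> and \<open>y\<close>. In \<open>h\<close> these three forms
  occur through the sum of their fourth powers and through their product, and both are free of
  \<open>\<omega>\<close>: the sum retains only exponents divisible by 3, and the product is the norm form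
  \<open>a\<^sup>3 + z\<^sup>3 + t\<^sup>3 - 3azt\<close>. What is left is an identity between binary forms in \<open>x\<close> and \<open>y\<close>, one for
  each monomial in \<open>z\<close> and \<open>t\<close> (\<open>pencil_coefficients\<close>; for \<open>z\<^sup>2t\<^sup>2\<close> it only compares constants).\<close>

section \<open>Evaluation and substitution of polynomials\<close>

lemma poly4_induct [case_names single add]:
  fixes f :: "'k::comm_monoid_add poly4"
  assumes "\<And>m c. P (Poly_Mapping.single m c)" and "\<And>f g. P f \<Longrightarrow> P g \<Longrightarrow> P (f + g)"
  shows "P f"
proof (induction f rule: Poly_Mapping.update_induct)
  case const
  show ?case using assms(1)[of 0 0] by simp
next
  case (update f m c)
  have "Poly_Mapping.update m c f = f + Poly_Mapping.single m c"
    using update(1)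
    by (intro poly_mapping_eqI)
      (auto simp: lookup_update lookup_add lookup_single when_def in_keys_iff)
  then show ?case using update(3) assms by simp
qed

text \<open>A ring homomorphism of the coefficients makes \<open>eval4\<close> a ring homomorphism. The identity map gives
  evaluation at a point, and the embedding of the constants gives substitution of polynomials.\<close>

locale coeff_hom =
  fixes \<phi> :: "'k::comm_ring_1 \<Rightarrow> 'r::comm_ring_1"
  assumes zero: "\<phi> 0 = 0" and one: "\<phi> 1 = 1"
    and add: "\<phi> (a + b) = \<phi> a + \<phi> b" and mult: "\<phi> (a * b) = \<phi> a * \<phi> b"
begin

text \<open>The sum over the support is extended to any larger finite set of exponents, so that two polynomials
  can be summed over a common index set.\<close>

lemma eval4_eq_sum:
  assumes "finite K" "Poly_Mapping.keys f \<subseteq> K"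
  shows "eval4 \<phi> \<theta> f = (\<Sum>m\<in>K. \<phi> (Poly_Mapping.lookup f m) *
           (\<Prod>j\<in>UNIV. \<theta> j ^ Poly_Mapping.lookup m j))"
  unfolding eval4_def using assms
  by (intro sum.mono_neutral_left) (auto simp: in_keys_iff zero)

lemma eval4_single:
  "eval4 \<phi> \<theta> (Poly_Mapping.single m c) = \<phi> c * (\<Prod>j\<in>UNIV. \<theta> j ^ Poly_Mapping.lookup m j)"
  by (subst eval4_eq_sum[of "{m}"]) auto

lemma eval4_add: "eval4 \<phi> \<theta> (f + g) = eval4 \<phi> \<theta> f + eval4 \<phi> \<theta> g"
proof -
  let ?K = "Poly_Mapping.keys f \<union> Poly_Mapping.keys g"
  have "Poly_Mapping.keys (f + g) \<subseteq> ?K" by (rule Poly_Mapping.keys_add)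
  then show ?thesis
    by (simp add: eval4_eq_sum[of ?K] lookup_add add distrib_right sum.distrib)
qed

lemma eval4_mult: "eval4 \<phi> \<theta> (f * g) = eval4 \<phi> \<theta> f * eval4 \<phi> \<theta> g"
proof (induction f rule: poly4_induct)
  case f: (single m c)
  show ?case
  proof (induction g rule: poly4_induct)
    case (single n d)
    show ?case
      by (simp add: mult_single eval4_single mult lookup_add power_add prod.distrib mult_ac)
  qed (simp add: distrib_left eval4_add)
qed (simp add: distrib_right eval4_add)

lemma eval4_Cst: "eval4 \<phi> \<theta> (Cst c) = \<phi> c"
  by (simp add: Cst_def eval4_single)

lemma eval4_Var: "eval4 \<phi> \<theta> (Var j) = \<theta> j"
proof -
  have "(\<Prod>l\<in>UNIV. \<theta> l ^ Poly_Mapping.lookup (Poly_Mapping.single j 1) l)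
      = (\<Prod>l\<in>UNIV. if l = j then \<theta> l else 1)"
    by (intro prod.cong) (auto simp: lookup_single when_def)
  then show ?thesis by (simp add: Var_def eval4_single one)
qed

lemma eval4_one: "eval4 \<phi> \<theta> 1 = 1"
  using eval4_Cst[of \<theta> 1] by (simp add: Cst_def one)

lemma eval4_zero: "eval4 \<phi> \<theta> 0 = 0"
  by (simp add: eval4_def)

lemma eval4_minus: "eval4 \<phi> \<theta> (- f) = - eval4 \<phi> \<theta> f"
  using eval4_add[of \<theta> "- f" f] by (simp add: eval4_zero eq_neg_iff_add_eq_0)

lemma eval4_diff: "eval4 \<phi> \<theta> (f - g) = eval4 \<phi> \<theta> f - eval4 \<phi> \<theta> g"
  using eval4_add[of \<theta> f "- g"] by (simp add: eval4_minus)

lemma eval4_power: "eval4 \<phi> \<theta> (f ^ n) = eval4 \<phi> \<theta> f ^ n"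
  by (induction n) (simp_all add: eval4_one eval4_mult)

lemma eval4_of_nat: "eval4 \<phi> \<theta> (of_nat n) = of_nat n"
  by (induction n) (simp_all add: eval4_one eval4_zero eval4_add)

lemma eval4_numeral: "eval4 \<phi> \<theta> (numeral n) = numeral n"
  using eval4_of_nat[of \<theta> "numeral n"] by simp

lemma eval4_sum: "eval4 \<phi> \<theta> (sum F I) = (\<Sum>i\<in>I. eval4 \<phi> \<theta> (F i))"
  by (induction I rule: infinite_finite_induct) (simp_all add: eval4_zero eval4_add)

lemma eval4_prod: "eval4 \<phi> \<theta> (prod F I) = (\<Prod>i\<in>I. eval4 \<phi> \<theta> (F i))"
  by (induction I rule: infinite_finite_induct) (simp_all add: eval4_one eval4_mult)

lemmas eval4_simps = eval4_add eval4_mult eval4_Cst eval4_Var eval4_one eval4_minus eval4_diff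
  eval4_power eval4_numeral eval4_sum

end

lemma Cst_simps:
  fixes a b :: "'k::comm_ring_1"
  shows "Cst (a + b) = Cst a + Cst b" "Cst (a - b) = Cst a - Cst b" "Cst (- a) = - Cst a"
    "Cst (a * b) = Cst a * Cst b" "Cst (0 :: 'k) = 0" "Cst (1 :: 'k) = 1"
    "Cst (numeral n :: 'k) = numeral n"
  by (simp_all add: Cst_def single_add single_diff single_uminus mult_single)

lemma Cst_power: "Cst (a ^ n) = Cst a ^ n" for a :: "'k::comm_ring_1"
  by (induction n) (simp_all add: Cst_simps)

interpretation point_eval: coeff_hom "id :: 'k \<Rightarrow> 'k::comm_ring_1"
  by unfold_locales simp_all

interpretation substitution: coeff_hom "Cst :: 'k \<Rightarrow> 'k::comm_ring_1 poly4"
  by unfold_locales (simp_all add: Cst_simps)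

lemma eval4_substitution:
  fixes f :: "'k::comm_ring_1 poly4"
  shows "eval4 id a (eval4 Cst \<theta> f) = eval4 id (\<lambda>j. eval4 id a (\<theta> j)) f"
proof (induction f rule: poly4_induct)
  case (single m c)
  show ?case
    unfolding substitution.eval4_single point_eval.eval4_single point_eval.eval4_mult
      point_eval.eval4_Cst point_eval.eval4_prod point_eval.eval4_power ..
next
  case (add f g)
  then show ?case unfolding substitution.eval4_add point_eval.eval4_add by (rule arg_cong2)
qed

lemma eval4_act_form:
  fixes f :: "'k::field poly4"
  shows "eval4 id (($) a) (act_form A f) = eval4 id (($) (matrix_inv A *v a)) f"
proof -
  have "(\<lambda>j. \<Sum>l\<in>UNIV. matrix_inv A $ j $ l * a $ l) = ($) (matrix_inv A *v a)"
    by (simp add: fun_eq_iff matrix_vector_mult_def)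
  then show ?thesis
    by (simp add: act_form_def eval4_substitution point_eval.eval4_simps)
qed


section \<open>Projective transformations and quartic surfaces\<close>

lemma mat_class_alt: "mat_class A = {mat c ** A | c. c \<noteq> 0}"
  by (auto simp: mat_class_def r_coset_def scalars4_def GL4_def)

lemma mat_class_carrier: "A \<in> carrier GL4 \<Longrightarrow> mat_class A \<in> carrier PGL4"
  by (auto simp: PGL4_def FactGroup_def mat_class_def RCOSETS_def)

lemma mat_vector_mult: "mat c *v a = c *s a" for a :: "'k::field ^ 4"
  by (simp add: vec_eq_iff forall_4 sum_4 matrix_vector_mult_def mat_def)

lemma act_point_mult: "act_point (g \<otimes>\<^bsub>PGL4\<^esub> h) p = act_point g (act_point h p)"
proof -
  have gh: "g \<otimes>\<^bsub>PGL4\<^esub> h = {A ** B | A B. A \<in> g \<and> B \<in> h}"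
    by (auto simp: PGL4_def FactGroup_def set_mult_def GL4_def)
  show ?thesis
    unfolding act_point_def gh
    by (auto simp: matrix_vector_mul_assoc) (metis matrix_vector_mul_assoc)+
qed

lemma act_point_mult_image:
  "act_point (g \<otimes>\<^bsub>PGL4\<^esub> h) ` S = act_point g ` act_point h ` S"
  by (simp add: act_point_mult image_image)

lemma act_point_mat_class: "act_point (mat_class A) (point a) = point (A *v a)"
proof
  have "(mat c ** A) *v (d *s a) = (c * d) *s (A *v a)" for c d
    by (simp add: matrix_vector_mul_assoc[symmetric] mat_vector_mult vector_scalar_commute
        vector_smult_assoc)
  then show "act_point (mat_class A) (point a) \<subseteq> point (A *v a)"
    by (force simp: act_point_def mat_class_alt point_def)
  show "point (A *v a) \<subseteq> act_point (mat_class A) (point a)"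
  proof
    fix b assume "b \<in> point (A *v a)"
    then obtain c where c: "c \<noteq> 0" "b = (mat c ** A) *v a"
      by (auto simp: point_def matrix_vector_mul_assoc[symmetric] mat_vector_mult)
    have "mat c ** A \<in> mat_class A" "a \<in> point a"
      using c by (auto simp: mat_class_alt point_def intro: exI[of _ 1])
    then show "b \<in> act_point (mat_class A) (point a)"
      using c(2) unfolding act_point_def by blast
  qed
qed

text \<open>The neutral class fixes the points of projective space, but not arbitrary sets of vectors; hence the
  restriction to sets of the form \<open>V f\<close>.\<close>

lemma act_point_one_V: "act_point \<one>\<^bsub>PGL4\<^esub> ` V f = V f"
proof -
  have "\<one>\<^bsub>PGL4\<^esub> = mat_class (mat 1 :: 'a ^ 4 ^ 4)"
    by (auto simp: PGL4_def FactGroup_def mat_class_alt scalars4_def)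
  then have "act_point \<one>\<^bsub>PGL4\<^esub> p = p" if "p \<in> V f" for p
    using that by (auto simp: V_def act_point_mat_class)
  then show ?thesis by simp
qed

text \<open>One inclusion moves points along \<open>A\<close>; for the other, a zero of \<open>g\<close> is pulled back along the inverse
  of \<open>A\<close>, where the factor \<open>c\<close> can be cancelled.\<close>

lemma act_point_V:
  assumes "A \<in> carrier GL4" "c \<noteq> 0"
    and eval: "\<And>a. eval4 id (($) (A *v a)) g = c * eval4 id (($) a) f"
  shows "act_point (mat_class A) ` V f = V g"
proof
  obtain B where AB: "A ** B = mat 1" and BA: "B ** A = mat 1"
    using assms(1) by (auto simp: GL4_def invertible_def)
  have nz: "A *v a \<noteq> 0" if "a \<noteq> 0" for a
  proof
    assume "A *v a = 0"
    then have "B *v (A *v a) = 0" by simp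
    then show False using that by (simp add: matrix_vector_mul_assoc BA)
  qed
  then show "act_point (mat_class A) ` V f \<subseteq> V g"
    by (force simp: V_def act_point_mat_class eval)
  show "V g \<subseteq> act_point (mat_class A) ` V f"
  proof
    fix p assume "p \<in> V g"
    then obtain b where b: "p = point b" "b \<noteq> 0" "eval4 id (($) b) g = 0"
      by (auto simp: V_def)
    have Ab: "A *v (B *v b) = b" by (simp add: matrix_vector_mul_assoc AB)
    then have "B *v b \<noteq> 0" "eval4 id (($) (B *v b)) f = 0"
      using b eval[of "B *v b"] assms(2) by auto
    then have "point (B *v b) \<in> V f" by (auto simp: V_def)
    then show "p \<in> act_point (mat_class A) ` V f"
      using b(1) Ab by (metis act_point_mat_class imageI)
  qed
qed

lemma subgroup_Paut_V: "subgroup (Paut (V f)) PGL4"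
proof -
  interpret group "PGL4 :: ('a ^ 4 ^ 4) set monoid" by (rule group_PGL4)
  show ?thesis
  proof (rule subgroupI)
    show "Paut (V f) \<noteq> {}" using act_point_one_V by (auto simp: Paut_def)
    show "inv\<^bsub>PGL4\<^esub> g \<in> Paut (V f)" if "g \<in> Paut (V f)" for g
      using that act_point_mult_image[of "inv\<^bsub>PGL4\<^esub> g" g "V f"] by (auto simp: Paut_def act_point_one_V)
  qed (auto simp: Paut_def act_point_mult_image)
qed

lemma conjugate_in_Paut:
  assumes "g \<in> carrier PGL4" "act_point g ` V f = V f'" "s \<in> Paut (V f')"
  shows "inv\<^bsub>PGL4\<^esub> g \<otimes>\<^bsub>PGL4\<^esub> s \<otimes>\<^bsub>PGL4\<^esub> g \<in> Paut (V f)"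
proof -
  interpret group "PGL4 :: ('a ^ 4 ^ 4) set monoid" by (rule group_PGL4)
  have "act_point (inv\<^bsub>PGL4\<^esub> g) ` V f' = V f"
    using assms(1) act_point_mult_image[of "inv\<^bsub>PGL4\<^esub> g" g "V f"] by (simp add: assms(2) act_point_one_V)
  then show ?thesis using assms by (simp add: Paut_def act_point_mult_image)
qed


section \<open>The invariant pencil of quartics\<close>

text \<open>The quadric and the quartic below are given over any commutative ring: they are used both for
  polynomials, where they are \<open>g\<^sub>0\<close> and a square root of \<open>g\<^sub>1\<close>, and for values at a point. The parameter
  \<open>s\<close> stands for the square root of 15. In \<open>quartic0\<close> the terms are grouped by their degree in \<open>x\<close>,
  because the coefficient of each power of \<open>x\<close> is separately invariant under the generators that fix
  the coordinate \<open>x\<close>.\<close>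

definition quadric :: "'r::comm_ring_1 \<Rightarrow> 'r \<Rightarrow> 'r \<Rightarrow> 'r \<Rightarrow> 'r" where
  "quadric x y z t = x\<^sup>2 + y\<^sup>2 + 2 * z * t"

definition quartic0 :: "'r::comm_ring_1 \<Rightarrow> 'r \<Rightarrow> 'r \<Rightarrow> 'r \<Rightarrow> 'r \<Rightarrow> 'r" where
  "quartic0 s x y z t = - (x ^ 4) + 2 * s * x * (y ^ 3 + z ^ 3 + t ^ 3 - 3 * y * z * t)
     + 13 * x\<^sup>2 * (y\<^sup>2 + 2 * z * t) + (10 * (z ^ 3 + t ^ 3) * y + 5 * z\<^sup>2 * t\<^sup>2 + 20 * y\<^sup>2 * z * t)"

lemma g0_form_eq: "g0_form s3 s5 = quartic0 (Cst (s3 * s5)) vx vy vz vt"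
  by (simp add: g0_form_def quartic0_def Let_def algebra_simps)

lemma g1_form_eq: "g1_form = (quadric vx vy vz vt)\<^sup>2"
  by (simp add: g1_form_def quadric_def algebra_simps power2_eq_square power4_eq_xxxx)

lemma invariant_swap:
  "quadric x y t z = quadric x y z t" "quartic0 s x y t z = quartic0 s x y z t"
  by (simp_all add: quadric_def quartic0_def algebra_simps)

text \<open>The variables \<open>z\<close> and \<open>t\<close> enter only through \<open>zt\<close>, \<open>z\<^sup>3\<close> and \<open>t\<^sup>3\<close>, which are unchanged by \<open>(z, t) \<mapsto> (wz, w\<^sup>2t)\<close>.\<close>

lemma invariant_cube_root_of_unity:
  assumes "w ^ 3 = 1"
  shows "quadric x y (w * z) (w\<^sup>2 * t) = quadric x y z t"
    "quartic0 s x y (w * z) (w\<^sup>2 * t) = quartic0 s x y z t"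
proof -
  have zt: "(w * z) * (w\<^sup>2 * t) = z * t"
    using assms by (simp add: power2_eq_square power3_eq_cube mult_ac)
      (metis mult.assoc mult.left_commute mult_1)
  have zt2: "(w * z)\<^sup>2 * (w\<^sup>2 * t)\<^sup>2 = z\<^sup>2 * t\<^sup>2"
    using zt by (metis power_mult_distrib)
  have t3: "(w\<^sup>2 * t) ^ 3 = t ^ 3"
    by (simp add: power_mult_distrib power_mult[symmetric])
      (use assms power_mult[of w 3 2] in simp)
  have z3: "(w * z) ^ 3 = z ^ 3" using assms by (simp add: power_mult_distrib)
  show "quadric x y (w * z) (w\<^sup>2 * t) = quadric x y z t"
    using zt by (simp add: quadric_def mult.assoc)
  show "quartic0 s x y (w * z) (w\<^sup>2 * t) = quartic0 s x y z t"
    unfolding quartic0_def z3 t3 mult.assoc using zt zt2 by (simp add: mult.assoc)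
qed

text \<open>With \<open>u\<close> one third of \<open>y + z + t\<close>, the matrix \<open>R12\<close> sends \<open>(y, z, t)\<close> to
  \<open>(2u - y, 2u - z, 2u - t)\<close>: it fixes the line \<open>y = z = t\<close> and is \<open>-1\<close> on the plane \<open>y + z + t = 0\<close>.
  Introducing \<open>u\<close> removes the denominators.\<close>

lemma invariant_reflection:
  fixes s x y z t u :: "'k::idom"
  assumes u: "y + z + t = 3 * u"
  shows "quadric x (2 * u - y) (2 * u - z) (2 * u - t) = quadric x y z t"
    "quartic0 s x (2 * u - y) (2 * u - z) (2 * u - t) = quartic0 s x y z t"
proof -
  have c: "(2 * u - y) ^ 3 + (2 * u - z) ^ 3 + (2 * u - t) ^ 3
      - 3 * (2 * u - y) * (2 * u - z) * (2 * u - t) = y ^ 3 + z ^ 3 + t ^ 3 - 3 * y * z * t"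
    using u by algebra
  have q: "(2 * u - y)\<^sup>2 + 2 * (2 * u - z) * (2 * u - t) = y\<^sup>2 + 2 * z * t"
    using u by algebra
  have r: "10 * ((2 * u - z) ^ 3 + (2 * u - t) ^ 3) * (2 * u - y)
      + 5 * (2 * u - z)\<^sup>2 * (2 * u - t)\<^sup>2 + 20 * (2 * u - y)\<^sup>2 * (2 * u - z) * (2 * u - t)
    = 10 * (z ^ 3 + t ^ 3) * y + 5 * z\<^sup>2 * t\<^sup>2 + 20 * y\<^sup>2 * z * t"
    using u by algebra
  show "quadric x (2 * u - y) (2 * u - z) (2 * u - t) = quadric x y z t"
    using q by (simp add: quadric_def add.assoc)
  show "quartic0 s x (2 * u - y) (2 * u - z) (2 * u - t) = quartic0 s x y z t"
    unfolding quartic0_def c q r ..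
qed

text \<open>The matrix \<open>R13\<close> is a reflection of the coordinates \<open>x, y\<close> followed by the exchange of \<open>z\<close> and \<open>t\<close>; only
  the reflection is treated here. The coordinates are scaled by 4 to avoid denominators.\<close>

lemma invariant_R13:
  fixes s x y z t :: "'k::idom"
  assumes s: "s\<^sup>2 = 15"
  shows "quadric (s * y - x) (s * x + y) z t = quadric (4 * x) (4 * y) z t"
    "quartic0 s (s * y - x) (s * x + y) z t = quartic0 s (4 * x) (4 * y) z t"
proof -
  have s1: "s * s = 15" using s by (simp add: power2_eq_square)
  have s2: "s * (s * b) = 15 * b" for b
    using arg_cong[OF s1, of "\<lambda>u. u * b"] by (simp add: mult.assoc)
  show "quadric (s * y - x) (s * x + y) z t = quadric (4 * x) (4 * y) z t"
    by (simp add: quadric_def algebra_simps power2_eq_square s2)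
  show "quartic0 s (s * y - x) (s * x + y) z t = quartic0 s (4 * x) (4 * y) z t"
    by (simp add: quartic0_def algebra_simps power2_eq_square power3_eq_cube power4_eq_xxxx s1 s2)
qed


section \<open>The quartic in the coordinates given by T\<close>

text \<open>The product of \<open>a + \<zeta>z + \<zeta>\<^sup>2t\<close> over the three cube roots of unity \<open>\<zeta>\<close> is the determinant of the
  circulant matrix of \<open>a, z, t\<close>.\<close>

lemma cubic_norm_form_factors:
  fixes w a z t :: "'r::comm_ring_1"
  assumes "w\<^sup>2 = - 1 - w"
  shows "(a + w * z + w\<^sup>2 * t) * (a + w\<^sup>2 * z + w * t) * (a + z + t) = a ^ 3 + z ^ 3 + t ^ 3 - 3 * a * z * t"
proof -
  have r1: "w * w = - 1 - w" using assms by (simp add: power2_eq_square)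
  have r2: "w * (w * b) = - b - w * b" for b
    using arg_cong[OF r1, of "\<lambda>u. u * b"] by (simp add: algebra_simps)
  show ?thesis unfolding assms by (simp add: algebra_simps power2_eq_square power3_eq_cube r1 r2)
qed

text \<open>Summing over the cube roots of unity \<open>\<zeta>\<close> keeps exactly the terms in which the exponent of \<open>\<zeta>\<close> is
  divisible by 3, each with a factor 3.\<close>

lemma sum_fourth_powers_roots_of_unity:
  fixes w a z t :: "'r::comm_ring_1"
  assumes "w\<^sup>2 = - 1 - w"
  shows "(a + w * z + w\<^sup>2 * t) ^ 4 + (a + w\<^sup>2 * z + w * t) ^ 4 + (a + z + t) ^ 4
    = 3 * (a ^ 4 + 12 * a\<^sup>2 * z * t + 4 * a * (z ^ 3 + t ^ 3) + 6 * z\<^sup>2 * t\<^sup>2)"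
proof -
  have r1: "w * w = - 1 - w" using assms by (simp add: power2_eq_square)
  have r2: "w * (w * b) = - b - w * b" for b
    using arg_cong[OF r1, of "\<lambda>u. u * b"] by (simp add: algebra_simps)
  show ?thesis unfolding assms by (simp add: algebra_simps power2_eq_square power3_eq_cube power4_eq_xxxx r1 r2)
qed

text \<open>The coefficients of \<open>1\<close>, \<open>zt\<close> and \<open>z\<^sup>3 + t\<^sup>3\<close> in the identity between the transformed quartic and
  the pencil. The forms \<open>a\<close> and \<open>d\<close> are 20 times those with which the inverse of \<open>T\<close> is naturally
  written, so that all coefficients are integral in \<open>i\<close> and \<open>s\<close> and the identities hold in every
  commutative ring; the factors \<open>40000\<close>, \<open>100\<close> and \<open>5\<close> are
  a quarter of \<open>20\<^sup>4\<close>, \<open>20\<^sup>2\<close> and \<open>20\<close>, the denominator 4 of \<open>\<lambda>\<close> having been cleared.\<close>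

lemma pencil_coefficients:
  fixes i s x y z t :: "'r::comm_ring_1"
  assumes "i\<^sup>2 = - 1" "s\<^sup>2 = 15"
  defines "a \<equiv> (i - 3) * s * x + 5 * (1 - 3 * i) * y"
      and "d \<equiv> - ((7 + i) * s * x) + 15 * (i - 1) * y"
  shows "(3 * i - 1) * (3 * a ^ 4 + d ^ 4 + 12 * i * a ^ 3 * d)
     = 40000 * (24 * (- (x ^ 4) + 2 * s * y ^ 3 * x + 13 * x\<^sup>2 * y\<^sup>2) + 6 * (9 * i - 8) * (x\<^sup>2 + y\<^sup>2)\<^sup>2)" (is ?A)
  "(3 * i - 1) * (36 * a\<^sup>2 - 36 * i * a * d)
     = 100 * (24 * (26 * x\<^sup>2 + 20 * y\<^sup>2 - 6 * s * x * y) + 24 * (9 * i - 8) * (x\<^sup>2 + y\<^sup>2))" (is ?B)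
  "(3 * i - 1) * (12 * a + 12 * i * d) = 5 * (24 * (2 * s * x + 10 * y))" (is ?C)
proof -
  have i1: "i * i = - 1" using assms by (simp add: power2_eq_square)
  have i2: "i * (i * b) = - b" for b
    using arg_cong[OF i1, of "\<lambda>u. u * b"] by (simp add: algebra_simps)
  have s1: "s * s = 15" using assms by (simp add: power2_eq_square)
  have s2: "s * (s * b) = 15 * b" for b
    using arg_cong[OF s1, of "\<lambda>u. u * b"] by (simp add: algebra_simps)
  show ?A ?B ?C unfolding a_def d_def
    by (simp_all add: algebra_simps power2_eq_square power3_eq_cube power4_eq_xxxx i1 i2 s1 s2)
qed


text \<open>Here \<open>L1\<close>, \<open>L2\<close>, \<open>L3\<close>, \<open>d\<close> are 60 times the coordinates of the inverse of \<open>T\<close> applied to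
  \<open>(x, y, z, t)\<close>. Since no division occurs, the identity can be used in the polynomial ring itself.\<close>

lemma pencil_identity:
  fixes i s w x y z t :: "'r::comm_ring_1"
  assumes i: "i\<^sup>2 = - 1" and s: "s\<^sup>2 = 15" and w: "w\<^sup>2 = - 1 - w"
  defines "a \<equiv> (i - 3) * s * x + 5 * (1 - 3 * i) * y"
      and "d \<equiv> - ((7 + i) * s * x) + 15 * (i - 1) * y"
  defines "L1 \<equiv> a + w * (20 * z) + w\<^sup>2 * (20 * t)"
      and "L2 \<equiv> i * (a + w\<^sup>2 * (20 * z) + w * (20 * t))"
      and "L3 \<equiv> a + 20 * z + 20 * t"
  shows "4 * (3 * i - 1) * (L1 ^ 4 + L2 ^ 4 + L3 ^ 4 + d ^ 4 + 12 * L1 * L2 * L3 * d)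
    = 160000 * (24 * quartic0 s x y z t + 6 * (9 * i - 8) * (quadric x y z t)\<^sup>2)"
proof -
  define Z where "Z = 20 * z"
  define T where "T = 20 * t"
  have "i ^ 4 = (i\<^sup>2)\<^sup>2" by (simp add: power_mult[symmetric])
  then have i4: "i ^ 4 = 1" using i by simp
  have "L1 ^ 4 + L2 ^ 4 + L3 ^ 4 = 3 * (a ^ 4 + 12 * a\<^sup>2 * Z * T + 4 * a * (Z ^ 3 + T ^ 3) + 6 * Z\<^sup>2 * T\<^sup>2)"
    using sum_fourth_powers_roots_of_unity[OF w, of a Z T]
    by (simp add: L1_def L2_def L3_def power_mult_distrib i4 Z_def T_def)
  moreover have "L1 * L2 * L3 = i * (a ^ 3 + Z ^ 3 + T ^ 3 - 3 * a * Z * T)"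
    unfolding cubic_norm_form_factors[OF w, symmetric] L1_def L2_def L3_def Z_def T_def
    by (simp only: mult_ac)
  \<comment> \<open>Sort by the monomials in \<open>Z\<close> and \<open>T\<close>, keeping the forms \<open>a\<close> and \<open>d\<close> closed.\<close>
  ultimately have "(3 * i - 1) * (L1 ^ 4 + L2 ^ 4 + L3 ^ 4 + d ^ 4 + 12 * (L1 * L2 * L3) * d)
    = (3 * i - 1) * (3 * a ^ 4 + d ^ 4 + 12 * i * a ^ 3 * d)
      + (3 * i - 1) * (36 * a\<^sup>2 - 36 * i * a * d) * (Z * T)
      + (3 * i - 1) * (12 * a + 12 * i * d) * (Z ^ 3 + T ^ 3)
      + 18 * (3 * i - 1) * Z\<^sup>2 * T\<^sup>2"
    by (simp only:) (simp add: algebra_simps)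
  also have "\<dots> = 40000 * (24 * quartic0 s x y z t + 6 * (9 * i - 8) * (quadric x y z t)\<^sup>2)"
    unfolding pencil_coefficients[OF i s, of x y, folded a_def d_def] Z_def T_def quartic0_def quadric_def
    by (simp add: algebra_simps power2_eq_square power3_eq_cube power4_eq_xxxx)
  finally have E: "(3 * i - 1) * (L1 ^ 4 + L2 ^ 4 + L3 ^ 4 + d ^ 4 + 12 * (L1 * L2 * L3) * d) = \<dots>" .
  have "4 * (3 * i - 1) * (L1 ^ 4 + L2 ^ 4 + L3 ^ 4 + d ^ 4 + 12 * L1 * L2 * L3 * d)
    = 4 * ((3 * i - 1) * (L1 ^ 4 + L2 ^ 4 + L3 ^ 4 + d ^ 4 + 12 * (L1 * L2 * L3) * d))"
    by (simp only: mult.assoc)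
  also note E
  finally show ?thesis by (simp only: mult.assoc[symmetric]) simp
qed

lemma matrix_inv_GL4:
  assumes "A \<in> carrier GL4"
  shows "matrix_inv A ** A = mat 1"
proof -
  have "\<exists>B. A ** B = mat 1 \<and> B ** A = mat 1"
    using assms by (simp add: GL4_def invertible_def)
  then show ?thesis unfolding matrix_inv_def by (rule someI2_ex) simp
qed

text \<open>The common factor of the entries is split off, so that the remaining entries are those in
  \<open>pencil_identity\<close>.\<close>

lemma matrix_inv_T_mat:
  fixes i s3 s5 :: "'k::field_char_0"
  assumes i: "i\<^sup>2 = - 1" and s3: "s3\<^sup>2 = 3" and s5: "s5\<^sup>2 = 5"
  defines "w \<equiv> omega i s3" and "s \<equiv> s3 * s5"
  shows "matrix_inv (T_mat i s3 s5) = mat (1 / 60) **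
    mat4 [[(i - 3) * s,       5 * (1 - 3 * i),       20 * w,       20 * w\<^sup>2],
          [i * ((i - 3) * s), i * (5 * (1 - 3 * i)), i * (20 * w\<^sup>2), i * (20 * w)],
          [(i - 3) * s,       5 * (1 - 3 * i),       20,           20],
          [- ((7 + i) * s),   15 * (i - 1),          0,            0]]" (is "_ = mat (1 / 60) ** ?Y")
proof -
  have w: "w\<^sup>2 = - 1 - w" unfolding w_def by (rule omega_root[OF i s3])
  have s: "s * s = 15" using s3 s5 by (simp add: s_def power2_eq_square mult_ac)
  have r1: "i * i = - 1" "w * w = - 1 - w" using i w by (simp_all add: power2_eq_square)
  have r2: "i * (i * a) = - a" "w * (w * a) = - a - w * a" for a
    using arg_cong[OF r1(1), of "\<lambda>u. u * a"] arg_cong[OF r1(2), of "\<lambda>u. u * a"]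
    by (simp_all add: mult.assoc left_diff_distrib)
  define M where "M = mat4 [[3 + i, 1 - 3 * i, 3 + i, 7 - i],
    [1 + 3 * i, 3 - i, 1 + 3 * i, - 3 - 3 * i], [w\<^sup>2, - i * w, 1, 0], [w, - i * w\<^sup>2, 1, 0]]"
  \<comment> \<open>The matrix \<open>?Y\<close> inverts \<open>M\<close> up to a diagonal matrix, which cancels the diagonal factor of \<open>T\<close>.\<close>
  have MY: "M ** ?Y = diag4 (- 80 * s) 240 60 60"
    unfolding M_def w diag4_def mat4_mult by (simp add: algebra_simps r1 r2)
  have "T_mat i s3 s5 ** (mat (1 / 60) ** ?Y) = diag4 (- s / 20) (1 / 4) 1 1 ** (M ** (mat (1 / 60) ** ?Y))"
    by (simp only: T_mat_def Let_def M_def w_def s_def matrix_mul_assoc)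
  also have "M ** (mat (1 / 60) ** ?Y) = mat (1 / 60) ** (M ** ?Y)"
    unfolding matrix_mul_assoc mat_scalar_comm[of "1 / 60" M] ..
  also have "diag4 (- s / 20) (1 / 4) 1 1 ** \<dots> = mat 1"
    unfolding MY diag4_def mat4_scalar mat4_mult by (simp add: s)
  finally have "T_mat i s3 s5 ** (mat (1 / 60) ** ?Y) = mat 1" .
  then have "matrix_inv (T_mat i s3 s5) ** T_mat i s3 s5 ** (mat (1 / 60) ** ?Y) = matrix_inv (T_mat i s3 s5)"
    by (simp only: matrix_mul_assoc[symmetric] matrix_mul_rid)
  then show ?thesis
    by (simp only: matrix_inv_GL4[OF T_mat_GL4[OF assms(1-3)]] matrix_mul_lid)
qed

text \<open>Homogeneity of degree 4 turns the common factor \<open>1 / 60\<close> of the substituted linear forms into its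
  fourth power, and the rest is \<open>pencil_identity\<close>. The constant on the left is \<open>27 / 8\<close> times the
  \<open>4 (3i - 1)\<close> occurring there.\<close>

lemma act_form_h:
  fixes i s3 s5 :: "'k::field_char_0"
  assumes i: "i\<^sup>2 = - 1" and s3: "s3\<^sup>2 = 3" and s5: "s5\<^sup>2 = 5"
  shows "Cst (27 * (- 1 + 3 * i) / 2) * act_form (T_mat i s3 s5) h_form
       = g0_form s3 s5 + Cst ((- 8 + 9 * i) / 4) * g1_form"
proof -
  define w where "w = omega i s3"
  define I where "I = Cst i"
  define W where "W = Cst w"
  define S where "S = Cst (s3 * s5)"
  define k where "k = (1 / 60 :: 'k)"
  define K where "K = Cst k"
  define a where "a = (I - 3) * S * vx + 5 * (1 - 3 * I) * vy"
  define d where "d = - ((7 + I) * S * vx) + 15 * (I - 1) * vy"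
  define L1 where "L1 = a + W * (20 * vz) + W\<^sup>2 * (20 * vt)"
  define L2 where "L2 = I * (a + W\<^sup>2 * (20 * vz) + W * (20 * vt))"
  define L3 where "L3 = a + 20 * vz + 20 * vt"
  have I: "I\<^sup>2 = - 1" by (simp add: I_def i Cst_simps flip: Cst_power)
  have W: "W\<^sup>2 = - 1 - W"
    by (simp add: W_def w_def omega_root[OF i s3] Cst_simps flip: Cst_power)
  have S: "S\<^sup>2 = 15" by (simp add: S_def power_mult_distrib s3 s5 Cst_simps flip: Cst_power)
  \<comment> \<open>The linear forms that are substituted for the variables in \<open>h\<close>.\<close>
  define \<theta> where "\<theta> j = (\<Sum>l\<in>UNIV. Cst (matrix_inv (T_mat i s3 s5) $ j $ l) * Var l)" for j
  have \<theta>: "\<theta> 1 = K * L1" "\<theta> 2 = K * L2" "\<theta> 3 = K * L3" "\<theta> 4 = K * d"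
    unfolding \<theta>_def matrix_inv_T_mat[OF assms, folded w_def k_def] mat4_scalar mat4_mult
    by (simp_all add: mat4_def vector_def sum_4 Cst_simps Cst_power algebra_simps K_def L1_def
        L2_def L3_def a_def d_def S_def W_def I_def)
  have "act_form (T_mat i s3 s5) h_form = K ^ 4 * (L1 ^ 4 + L2 ^ 4 + L3 ^ 4 + d ^ 4 + 12 * L1 * L2 * L3 * d)"
    unfolding act_form_def \<theta>_def[symmetric]
    by (simp add: h_form_def substitution.eval4_simps \<theta> algebra_simps power4_eq_xxxx)
  moreover have "Cst (27 * (- 1 + 3 * i) / 2) = Cst (27 / 8) * (4 * (3 * I - 1))"
  proof -
    have "27 * (- 1 + 3 * i) / 2 = 27 / 8 * (4 * (3 * i - 1))" by (simp add: field_simps)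
    then show ?thesis by (simp only: I_def Cst_simps)
  qed
  ultimately have "Cst (27 * (- 1 + 3 * i) / 2) * act_form (T_mat i s3 s5) h_form
    = Cst (27 / 8) * K ^ 4 * (4 * (3 * I - 1) * (L1 ^ 4 + L2 ^ 4 + L3 ^ 4 + d ^ 4 + 12 * L1 * L2 * L3 * d))"
    by (simp only: mult_ac)
  also have "\<dots> = (Cst (27 / 8) * K ^ 4 * 160000 * 24) * g0_form s3 s5
      + (Cst (27 / 8) * K ^ 4 * 160000 * 6 * (9 * I - 8)) * g1_form"
    unfolding pencil_identity[OF I S W, of vx vy vz vt, folded a_def d_def, folded L1_def L2_def L3_def]
      g0_form_eq g1_form_eq S_def[symmetric]
    by (simp only: distrib_left mult.assoc)
  also have "Cst (27 / 8) * K ^ 4 * 160000 * 24 = 1"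
  proof -
    have "27 / 8 * k ^ 4 * 160000 * 24 = 1" by (simp add: k_def power_divide)
    from arg_cong[OF this, of Cst] show ?thesis by (simp only: Cst_simps Cst_power K_def)
  qed
  also have "Cst (27 / 8) * K ^ 4 * 160000 * 6 * (9 * I - 8) = Cst ((- 8 + 9 * i) / 4)"
  proof -
    have "27 / 8 * k ^ 4 * 160000 * 6 * (9 * i - 8) = (- 8 + 9 * i) / 4"
      by (simp add: k_def power_divide)
    from arg_cong[OF this, of Cst] show ?thesis
      by (simp only: Cst_simps(1-4,7) Cst_power K_def I_def)
  qed
  finally show ?thesis by simp
qed

lemma eval4_pencil:
  "eval4 id (($) v) (g0_form s3 s5 + Cst l * g1_form)
     = quartic0 (s3 * s5) (v $ 1) (v $ 2) (v $ 3) (v $ 4) + l * (quadric (v $ 1) (v $ 2) (v $ 3) (v $ 4))\<^sup>2"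
  unfolding g0_form_eq g1_form_eq
  by (simp add: quartic0_def quadric_def point_eval.eval4_simps)

lemma mat4_vec:
  "mat4 [[a11, a12, a13, a14], [a21, a22, a23, a24], [a31, a32, a33, a34], [a41, a42, a43, a44]] *v v
   = vector [a11 * v $ 1 + a12 * v $ 2 + a13 * v $ 3 + a14 * v $ 4,
             a21 * v $ 1 + a22 * v $ 2 + a23 * v $ 3 + a24 * v $ 4,
             a31 * v $ 1 + a32 * v $ 2 + a33 * v $ 3 + a34 * v $ 4,
             a41 * v $ 1 + a42 * v $ 2 + a43 * v $ 3 + a44 * v $ 4]"
  by (simp add: vec_eq_iff forall_4 sum_4 matrix_vector_mult_def mat4_def vector_def)

lemma vector4_nth:
  "vector [a, b, c, d] $ (1 :: 4) = a" "vector [a, b, c, d] $ (2 :: 4) = b"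
  "vector [a, b, c, d] $ (3 :: 4) = c" "vector [a, b, c, d] $ (4 :: 4) = d"
  by (simp_all add: vector_def)

text \<open>The stabilizer of a surface is a group, so it is enough to test the generators; each of them fixes
  the value of the quartic at every vector, not only up to a factor.\<close>

lemma S5_1_subset_Paut:
  fixes i s3 s5 l :: "'k::field_char_0"
  assumes i: "i\<^sup>2 = - 1" and s3: "s3\<^sup>2 = 3" and s5: "s5\<^sup>2 = 5"
  shows "S5_1 i s3 s5 \<subseteq> Paut (V (g0_form s3 s5 + Cst l * g1_form))" (is "_ \<subseteq> Paut (V ?g)")
proof -
  interpret group "PGL4 :: ('k ^ 4 ^ 4) set monoid" by (rule group_PGL4)
  define s where "s = s3 * s5"
  define w where "w = omega i s3"
  have s: "s\<^sup>2 = 15" by (simp add: s_def power_mult_distrib s3 s5)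
  have "w\<^sup>2 = - 1 - w" unfolding w_def by (rule omega_root[OF i s3])
  then have w: "w ^ 3 = 1" by algebra
  have mem: "mat_class A \<in> Paut (V ?g)"
    if "A \<in> carrier GL4" "\<And>v. eval4 id (($) (A *v v)) ?g = eval4 id (($) v) ?g" for A
    using that act_point_V[of A 1 ?g ?g] by (simp add: Paut_def mat_class_carrier)
  have GL: "R11 i s3 \<in> carrier GL4" "(R12 :: 'k ^ 4 ^ 4) \<in> carrier GL4" "R13 s3 s5 \<in> carrier GL4"
    "(R14 :: 'k ^ 4 ^ 4) \<in> carrier GL4"
    using R_GL4[OF assms] by auto
  have "mat_class (R11 i s3) \<in> Paut (V ?g)"
    by (intro mem GL) (simp add: eval4_pencil R11_def diag4_def mat4_vec vector4_nth
        invariant_cube_root_of_unity[OF w[unfolded w_def]])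
  moreover have "mat_class R12 \<in> Paut (V ?g)"
  proof (intro mem GL)
    fix v :: "'k ^ 4"
    define u where "u = (v $ 2 + v $ 3 + v $ 4) / 3"
    have u: "v $ 2 + v $ 3 + v $ 4 = 3 * u" by (simp add: u_def)
    have "R12 *v v = vector [v $ 1, 2 * u - v $ 2, 2 * u - v $ 3, 2 * u - v $ 4]"
      unfolding R12_def mat4_vec u_def by (intro arg_cong[of _ _ vector]) (simp add: field_simps)
    then show "eval4 id (($) (R12 *v v)) ?g = eval4 id (($) v) ?g"
      by (simp add: eval4_pencil vector4_nth invariant_reflection[OF u])
  qed
  moreover have "mat_class (R13 s3 s5) \<in> Paut (V ?g)"
  proof (intro mem GL)
    fix v :: "'k ^ 4"
    define x where "x = v $ 1 / 4"
    define y where "y = v $ 2 / 4"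
    have v: "v $ 1 = 4 * x" "v $ 2 = 4 * y" by (simp_all add: x_def y_def)
    have "R13 s3 s5 *v v = vector [s * y - x, s * x + y, v $ 4, v $ 3]"
      unfolding R13_def mat4_vec v s_def by (simp add: mult.assoc)
    then show "eval4 id (($) (R13 s3 s5 *v v)) ?g = eval4 id (($) v) ?g"
      by (simp add: eval4_pencil vector4_nth v invariant_R13[OF s] invariant_swap flip: s_def)
  qed
  moreover have "mat_class R14 \<in> Paut (V ?g)"
    by (intro mem GL) (simp add: eval4_pencil R14_def mat4_vec vector4_nth invariant_swap)
  ultimately show ?thesis
    unfolding S5_1_def by (intro generate_subgroup_incl subgroup_Paut_V) auto
qed

theorem proposition5p2:
  fixes i s3 s5 :: "'k::{alg_closed_field, field_char_0}"
  assumes "i\<^sup>2 = - 1" and "s3\<^sup>2 = 3" and "s5\<^sup>2 = 5"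
  shows "(let T = mat_class (T_mat i s3 s5);
              H = inv\<^bsub>PGL4\<^esub> T <#\<^bsub>PGL4\<^esub> S5_1 i s3 s5 #>\<^bsub>PGL4\<^esub> T
          in subgroup H PGL4 \<and> H \<subseteq> G1920)
       \<and> Cst (27 * (- 1 + 3 * i) / 2) * act_form (T_mat i s3 s5) h_form
         = g0_form s3 s5 + Cst ((- 8 + 9 * i) / 4) * g1_form"
proof -
  interpret group "PGL4 :: ('k ^ 4 ^ 4) set monoid" by (rule group_PGL4)
  let ?M = "T_mat i s3 s5" and ?g = "g0_form s3 s5 + Cst ((- 8 + 9 * i) / 4) * g1_form"
  let ?T = "mat_class ?M"
  let ?H = "inv\<^bsub>PGL4\<^esub> ?T <#\<^bsub>PGL4\<^esub> S5_1 i s3 s5 #>\<^bsub>PGL4\<^esub> ?T"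
  have M: "?M \<in> carrier GL4" by (rule T_mat_GL4[OF assms])
  then have T: "?T \<in> carrier PGL4" by (rule mat_class_carrier)
  have forms: "Cst (27 * (- 1 + 3 * i) / 2) * act_form ?M h_form = ?g"
    by (rule act_form_h[OF assms])
  have V: "act_point ?T ` V h_form = V ?g"
  proof (rule act_point_V[OF M])
    fix v
    have "matrix_inv ?M *v (?M *v v) = v"
      by (simp add: matrix_vector_mul_assoc matrix_inv_GL4[OF M])
    then show "eval4 id (($) (?M *v v)) ?g = 27 * (- 1 + 3 * i) / 2 * eval4 id (($) v) h_form"
      unfolding forms[symmetric] by (simp add: point_eval.eval4_simps eval4_act_form)
    \<comment> \<open>The norm of \<open>-1 + 3i\<close> is 10, which is not zero in characteristic zero.\<close>
    have "(- 1 + 3 * i) * (- 1 - 3 * i) = 10" using assms(1) by algebra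
    then show "27 * (- 1 + 3 * i) / 2 \<noteq> 0" by auto
  qed
  have gens: "{mat_class (R11 i s3), mat_class R12, mat_class (R13 s3 s5), mat_class R14} \<subseteq> carrier PGL4"
    using R_GL4[OF assms] by (auto intro: mat_class_carrier)
  have "subgroup ?H PGL4"
    using subgroup_conjugation_is_surj1[OF T] generate_is_subgroup[OF gens] by (simp add: S5_1_def)
  moreover have "?H \<subseteq> G1920"
    using conjugate_in_Paut[OF T V] S5_1_subset_Paut[OF assms]
    by (auto simp: l_coset_def r_coset_def)
  ultimately show ?thesis using forms by (simp add: Let_def)
qed

end
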